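(* Let $p$ be a prime and let $f(x)=a_{n_r}x^{n_r}+a_{n_{r-1}}x^{n_{r-1}}+\cdots+a_{n_1}x^{n_1}+p^u\epsilon\in \mathcal{S}_1\cup \mathcal{S}_2'\cup \mathcal{S}_3'$ with $p^u>|a_{n_1}|+\cdots+|a_{n_r}|$. Then $f(x)$ is irreducible over $\mathbb{Z}$.
   Context: Let $p$ be a prime number. For a positive integer $n_1$, $\mathcal{S}_{n_1}$ denotes the set of all polynomials $a_{n_r}x^{n_r}+a_{n_{r-1}}x^{n_{r-1}}+\cdots+a_{n_1}x^{n_1}+p^u\epsilon\in\mathbb{Z}[x]$ (with $r\ge 1$) such that $n_r>n_{r-1}>\cdots>n_1>0$ are integers, $u\ge 2$ is an integer, $\epsilon=\pm 1$, $p\nmid a_{n_1}a_{n_r}$, and every $a_{n_i}$ is a nonzero integer. Thus $n_1$ is the smallest positive exponent occurring. Also $\mathcal{S}_{n_1}'=\{f\in\mathcal{S}_{n_1}\mid u\not\equiv 0\pmod{n_1}\}$. *)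

theory Defs
  imports
    "HOL-Computational_Algebra.Computational_Algebra"
    "HOL-Number_Theory.Cong"
begin

text \<open>
  \<open>S_form p r n a u \<epsilon> f\<close> says that
  \<open>f = a\<^sub>r x^(n\<^sub>r) + \<dots> + a\<^sub>1 x^(n\<^sub>1) + p^u \<epsilon>\<close>
  is a presentation of the kind considered. The terms are indexed by \<open>i \<in> {1..r}\<close>;
  \<open>a i\<close> is the coefficient of \<open>x^(n i)\<close>, and values of \<open>n\<close> and \<open>a\<close> outside
  \<open>{1..r}\<close> are irrelevant.
\<close>

definition S_form ::
  "nat \<Rightarrow> nat \<Rightarrow> (nat \<Rightarrow> nat) \<Rightarrow> (nat \<Rightarrow> int) \<Rightarrow> nat \<Rightarrow> int \<Rightarrow> int poly \<Rightarrow> bool"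
  where
  "S_form p r n a u \<epsilon> f \<longleftrightarrow>
     r \<ge> 1 \<and> strict_mono_on {1..r} n \<and> n 1 > 0 \<and>
     u \<ge> 2 \<and> (\<epsilon> = 1 \<or> \<epsilon> = -1) \<and>
     \<not> int p dvd a 1 * a r \<and> (\<forall>i\<in>{1..r}. a i \<noteq> 0) \<and>
     f = (\<Sum>i=1..r. monom (a i) (n i)) + [:int p ^ u * \<epsilon>:]"

definition S :: "nat \<Rightarrow> nat \<Rightarrow> int poly set" where
  "S p n\<^sub>1 = {f. \<exists>r n a u \<epsilon>. S_form p r n a u \<epsilon> f \<and> n 1 = n\<^sub>1}"

text \<open>For \<open>p \<ge> 2\<close> the exponent \<open>u\<close> is determined by \<open>f\<close>, since \<open>p^u\<close> is the
  absolute value of the constant coefficient.\<close>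

definition S' :: "nat \<Rightarrow> nat \<Rightarrow> int poly set" where
  "S' p n\<^sub>1 = {f. \<exists>r n a u \<epsilon>. S_form p r n a u \<epsilon> f \<and> n 1 = n\<^sub>1 \<and> \<not> [u = 0] (mod n\<^sub>1)}"

end

theory Submission
  imports Defs
begin

text \<open>
  Since the constant coefficient dominates the sum of all the others in absolute value, every
  complex root of \<open>f\<close> lies strictly outside the closed unit disc
  (\<open>norm_root_gt_1_if_constant_dominates\<close>). By Vieta, a nonconstant factor \<open>g \<in> \<int>[x]\<close> of \<open>f\<close> then
  satisfies \<open>\<bar>g(0)\<bar> > \<bar>lead_coeff g\<bar> \<ge> 1\<close>. As \<open>g(0)\<close> divides \<open>p^u\<close>, the prime \<open>p\<close> divides
  the constant coefficient of \<^emph>\<open>every\<close> nonconstant factor. Constant factors are units,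
  because they divide both a power of \<open>p\<close> and the leading coefficient, which is prime to \<open>p\<close>.

  Suppose now \<open>f = g h\<close> with both factors nonconstant, and write \<open>g\<^sub>i\<close>, \<open>h\<^sub>i\<close> for the
  coefficients and \<open>m\<close> for the smallest positive exponent of \<open>f\<close>. Comparing the coefficients
  of \<open>x, \<dots>, x^m\<close> with \<open>p \<bar> g\<^sub>0, h\<^sub>0\<close> in mind gives:

  \<^item> for \<open>m = 1\<close>, that \<open>g\<^sub>0 h\<^sub>1 + g\<^sub>1 h\<^sub>0\<close> is divisible by \<open>p\<close> and also prime to \<open>p\<close>;
  \<^item> for \<open>m = 2\<close>, that \<open>g\<^sub>1\<close> and \<open>h\<^sub>1\<close> are prime to \<open>p\<close>, so \<open>g\<^sub>0 h\<^sub>1 = - g\<^sub>1 h\<^sub>0\<close> forces \<open>g\<^sub>0\<close> and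
    \<open>h\<^sub>0\<close> to have the same \<open>p\<close>-adic valuation, and \<open>u\<close> is even;
  \<^item> for \<open>m = 3\<close>, that up to exchanging the factors \<open>g\<^sub>1\<close> and \<open>h\<^sub>2\<close> are prime to \<open>p\<close> while
    \<open>p\<close> divides \<open>h\<^sub>1\<close>; the two vanishing coefficients then force the valuation of \<open>h\<^sub>0\<close> to be
    twice that of \<open>g\<^sub>0\<close> (\<open>multiplicity_double_if_low_coeffs_vanish\<close>), and \<open>3\<close> divides \<open>u\<close>.
\<close>

section \<open>Polynomials whose roots lie outside the unit disc\<close>

lemma norm_root_gt_1_if_constant_dominates:
  fixes b :: "'b \<Rightarrow> int" and z :: complex
  assumes dom: "(\<Sum>i\<in>I. \<bar>b i\<bar>) < \<bar>c\<bar>"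
    and root: "(\<Sum>i\<in>I. of_int (b i) * z ^ e i) + of_int c = 0"
  shows "norm z > 1"
proof (rule ccontr)
  assume "\<not> norm z > 1"
  hence z: "norm z ^ k \<le> 1" for k
    by (simp add: power_le_one)
  have "norm (of_int c :: complex) = norm (\<Sum>i\<in>I. of_int (b i) * z ^ e i)"
    using root by (metis add_eq_0_iff norm_minus_cancel)
  also have "\<dots> \<le> (\<Sum>i\<in>I. of_int \<bar>b i\<bar>)"
    by (rule sum_norm_le) (use z in \<open>simp add: norm_mult norm_power mult_left_le\<close>)
  finally have "of_int \<bar>c\<bar> \<le> (of_int (\<Sum>i\<in>I. \<bar>b i\<bar>) :: real)"
    by simp
  with dom show False
    by linarith
qed

lemma map_poly_of_int_mult:
  "map_poly of_int (g * h) = (map_poly of_int g * map_poly of_int h :: 'a :: comm_ring_1 poly)"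
  by (rule poly_eqI) (simp add: coeff_map_poly coeff_mult)

text \<open>By Vieta, \<open>\<bar>g(0)\<bar>\<close> is \<open>\<bar>lead_coeff g\<bar>\<close> times the product of the moduli of the roots.\<close>

lemma abs_constant_coeff_gt_1_if_roots_outside_disc:
  fixes g :: "int poly"
  assumes deg: "degree g > 0"
    and roots: "\<And>z :: complex. poly (map_poly of_int g) z = 0 \<Longrightarrow> norm z > 1"
  shows "\<bar>coeff g 0\<bar> > 1"
proof -
  define G :: "complex poly" where "G = map_poly of_int g"
  have degG: "degree G = degree g" and lc: "lead_coeff G = of_int (lead_coeff g)"
    unfolding G_def by (simp_all add: degree_map_poly coeff_map_poly)
  obtain root where
    dec: "smult (lead_coeff G) (\<Prod>i<degree G. [:-root i, 1:]) = G"
    using complex_poly_decompose' by blast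
  have val: "poly G z = lead_coeff G * (\<Prod>i<degree G. z - root i)" for z
    by (subst dec [symmetric]) (simp add: poly_prod)
  have big: "norm (root i) > 1" if "i < degree G" for i
  proof (rule roots)
    show "poly (map_poly of_int g) (root i) = 0"
      using val [of "root i"] that by (auto simp: G_def)
  qed
  have "1 < (\<Prod>i<degree G. norm (root i))"
  proof -
    have "1 < norm (root 0)"
      using big deg degG by simp
    also have "\<dots> \<le> norm (root 0) * (\<Prod>i\<in>{..<degree G} - {0}. norm (root i))"
    proof -
      have "1 \<le> (\<Prod>i\<in>{..<degree G} - {0}. norm (root i))"
        using big by (intro prod_ge_1) (auto intro: less_imp_le)
      thus ?thesis
        using mult_left_mono [of 1 _ "norm (root 0)"] by simp
    qed
    also have "\<dots> = (\<Prod>i<degree G. norm (root i))"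
      using deg degG by (subst prod.remove [of _ 0]) auto
    finally show ?thesis .
  qed
  moreover have "norm (lead_coeff G) \<ge> 1"
  proof -
    have "\<bar>lead_coeff g\<bar> \<ge> 1"
      using deg by (metis degree_0 int_one_le_iff_zero_less leading_coeff_0_iff less_irrefl zero_less_abs_iff)
    thus ?thesis
      unfolding lc by simp
  qed
  moreover have "of_int \<bar>coeff g 0\<bar> = norm (lead_coeff G) * (\<Prod>i<degree G. norm (root i))"
  proof -
    have "of_int \<bar>coeff g 0\<bar> = norm (poly G 0)"
      by (simp add: G_def poly_0_coeff_0 coeff_map_poly)
    thus ?thesis
      by (simp add: val norm_mult prod_norm [symmetric])
  qed
  ultimately have "of_int \<bar>coeff g 0\<bar> > (1 :: real)"
    by (smt (verit) mult_le_cancel_right1)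
  thus ?thesis
    by linarith
qed

section \<open>Divisors of powers of a prime, and valuations of low coefficients\<close>

lemma unit_if_dvd_prime_power:
  fixes p c :: "'a :: factorial_semiring"
  assumes "prime_elem p" "c dvd p ^ k" "\<not> p dvd c"
  shows "is_unit c"
  using assms
proof (induction k)
  case (Suc k)
  from Suc.prems obtain d where d: "p ^ Suc k = c * d"
    by (elim dvdE)
  have "p dvd c * d"
    unfolding d [symmetric] by simp
  with Suc.prems obtain d' where "d = p * d'"
    by (auto simp: prime_elem_dvd_mult_iff)
  with d have "p * p ^ k = p * (c * d')"
    by (simp add: mult.left_commute)
  hence "p ^ k = c * d'"
    using Suc.prems(1) by (simp add: prime_elem_def)
  with Suc show ?case
    by simp
qed simp

text \<open>
  Let \<open>v\<close> be the \<open>p\<close>-adic valuation. As \<open>v(g\<^sub>1) = 0 < v(h\<^sub>1)\<close>, the first relation gives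
  \<open>v(h\<^sub>0) = v(g\<^sub>0) + v(h\<^sub>1) > v(g\<^sub>0)\<close>. So in the second relation the term \<open>g\<^sub>2 h\<^sub>0\<close> has larger
  valuation than \<open>g\<^sub>0 h\<^sub>2\<close>, whose valuation is \<open>v(g\<^sub>0)\<close>. Hence \<open>g\<^sub>0 h\<^sub>2\<close> must be balanced by
  \<open>g\<^sub>1 h\<^sub>1\<close>, that is, \<open>v(h\<^sub>1) = v(g\<^sub>0)\<close>.
\<close>

lemma multiplicity_double_if_low_coeffs_vanish:
  fixes p :: int
  assumes p: "prime_elem p"
    and nz: "g0 \<noteq> 0" "h0 \<noteq> 0"
    and x1: "g0 * h1 + g1 * h0 = 0"
    and x2: "g0 * h2 + g1 * h1 + g2 * h0 = 0"
    and ndvd: "\<not> p dvd g1" "\<not> p dvd h2"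
    and dvd: "p dvd h1"
  shows "multiplicity p h0 = 2 * multiplicity p g0"
proof -
  define s where "s = multiplicity p g0"
  have nu: "\<not> is_unit p"
    using p by auto
  have "h1 \<noteq> 0" "g1 \<noteq> 0" "h2 \<noteq> 0"
    using x1 nz ndvd by auto
  have "g0 * h1 = - (g1 * h0)"
    using x1 by linarith
  hence "multiplicity p (g0 * h1) = multiplicity p (g1 * h0)"
    by simp
  hence h0: "multiplicity p h0 = s + multiplicity p h1"
    using p nz \<open>h1 \<noteq> 0\<close> \<open>g1 \<noteq> 0\<close> ndvd(1)
    by (simp add: prime_elem_multiplicity_mult_distrib not_dvd_imp_multiplicity_0 s_def)
  have "multiplicity p h1 \<ge> 1"
    using dvd nu \<open>h1 \<noteq> 0\<close> by (intro multiplicity_geI) auto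
  hence h0_dvd: "p ^ Suc s dvd h0"
    using h0 by (intro multiplicity_dvd') simp
  have "multiplicity p h1 = s"
  proof (rule multiplicity_eqI)
    have "p ^ s dvd g0 * h2 + g2 * h0"
      using h0_dvd unfolding s_def
      by (intro dvd_add dvd_mult dvd_mult2 multiplicity_dvd) (auto dest: power_le_dvd)
    moreover have "g0 * h2 + g2 * h0 = - (g1 * h1)"
      using x2 by linarith
    ultimately have "p ^ s dvd g1 * h1"
      by simp
    hence "s \<le> multiplicity p (g1 * h1)"
      using nu \<open>h1 \<noteq> 0\<close> \<open>g1 \<noteq> 0\<close> by (intro multiplicity_geI) auto
    hence "s \<le> multiplicity p h1"
      using p \<open>h1 \<noteq> 0\<close> \<open>g1 \<noteq> 0\<close> ndvd(1)
      by (simp add: prime_elem_multiplicity_mult_distrib not_dvd_imp_multiplicity_0)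
    thus "p ^ s dvd h1"
      by (rule multiplicity_dvd')
  next
    show "\<not> p ^ Suc s dvd h1"
    proof
      assume "p ^ Suc s dvd h1"
      hence "p ^ Suc s dvd g1 * h1 + g2 * h0"
        using h0_dvd by (intro dvd_add dvd_mult)
      moreover have "g1 * h1 + g2 * h0 = - (g0 * h2)"
        using x2 by linarith
      ultimately have "p ^ Suc s dvd g0 * h2"
        by simp
      hence "Suc s \<le> multiplicity p (g0 * h2)"
        using nu nz \<open>h2 \<noteq> 0\<close> by (intro multiplicity_geI) auto
      thus False
        using p nz \<open>h2 \<noteq> 0\<close> ndvd(2)
        by (simp add: prime_elem_multiplicity_mult_distrib not_dvd_imp_multiplicity_0 s_def)
    qed
  qed
  with h0 show ?thesis
    by (simp add: s_def)
qed

section \<open>The coefficients of the polynomials considered\<close>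

lemma coeff_S_form:
  assumes "S_form p r n a u \<epsilon> f"
  shows coeff_S_form_0: "coeff f 0 = int p ^ u * \<epsilon>"
    and coeff_S_form_gap: "0 < k \<Longrightarrow> k < n 1 \<Longrightarrow> coeff f k = 0"
    and coeff_S_form_exponent: "j \<in> {1..r} \<Longrightarrow> coeff f (n j) = a j"
proof -
  have mono: "strict_mono_on {1..r} n" and pos: "n 1 > 0"
    and f: "f = (\<Sum>i=1..r. monom (a i) (n i)) + [:int p ^ u * \<epsilon>:]"
    using assms by (auto simp: S_form_def)
  have ge: "n 1 \<le> n i" if "i \<in> {1..r}" for i
    using strict_mono_onD [OF mono, of 1 i] that by (cases "i = 1") auto
  have coeff: "coeff f k = (\<Sum>i=1..r. if n i = k then a i else 0) + (if k = 0 then int p ^ u * \<epsilon> else 0)"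
    for k
    by (simp add: f coeff_sum coeff_pCons split: nat.splits)
  have gap: "(\<Sum>i=1..r. if n i = k then a i else 0) = 0" if "k < n 1" for k
    using that ge by (intro sum.neutral) fastforce
  show "coeff f 0 = int p ^ u * \<epsilon>"
    using gap pos by (simp add: coeff)
  show "coeff f k = 0" if "0 < k" "k < n 1" for k
    using gap that by (simp add: coeff)
  show "coeff f (n j) = a j" if j: "j \<in> {1..r}" for j
  proof -
    have "n i = n j \<longleftrightarrow> i = j" if "i \<in> {1..r}" for i
      using strict_mono_on_imp_inj_on [OF mono] that j by (auto dest: inj_onD)
    hence "(\<Sum>i=1..r. if n i = n j then a i else 0) = (\<Sum>i=1..r. if i = j then a i else 0)"
      by (intro sum.cong) auto
    also have "\<dots> = a j"
      using j by simp
    finally show ?thesis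
      using ge [OF j] pos by (simp add: coeff)
  qed
qed

lemma norm_root_S_form_gt_1:
  fixes z :: complex
  assumes form: "S_form p r n a u \<epsilon> f"
    and dom: "int p ^ u > (\<Sum>i=1..r. \<bar>a i\<bar>)"
    and root: "poly (map_poly of_int f) z = 0"
  shows "norm z > 1"
proof (rule norm_root_gt_1_if_constant_dominates)
  have f: "f = (\<Sum>i=1..r. monom (a i) (n i)) + [:int p ^ u * \<epsilon>:]" and \<epsilon>: "\<bar>\<epsilon>\<bar> = 1"
    using form by (auto simp: S_form_def)
  have "map_poly of_int f =
      (\<Sum>i=1..r. monom (of_int (a i)) (n i)) + [:of_int (int p ^ u * \<epsilon>) :: complex:]"
    unfolding f by (intro poly_eqI) (auto simp: coeff_map_poly coeff_sum coeff_pCons split: nat.splits intro!: sum.cong)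
  with root show "(\<Sum>i=1..r. of_int (a i) * z ^ n i) + of_int (int p ^ u * \<epsilon>) = 0"
    by (simp add: poly_sum poly_monom)
  show "(\<Sum>i=1..r. \<bar>a i\<bar>) < \<bar>int p ^ u * \<epsilon>\<bar>"
    using dom \<epsilon> by (simp add: abs_mult)
qed

section \<open>Comparing the low coefficients of a factorisation\<close>

lemma coeff_mult_1: "coeff (g * h) 1 = coeff g 0 * coeff h 1 + coeff g 1 * coeff h 0"
  for g h :: "'a :: comm_semiring_0 poly"
  by (simp add: coeff_mult numeral_eq_Suc)

lemma coeff_mult_2:
  "coeff (g * h) 2 = coeff g 0 * coeff h 2 + coeff g 1 * coeff h 1 + coeff g 2 * coeff h 0"
  for g h :: "'a :: comm_semiring_0 poly"
  by (simp add: coeff_mult numeral_eq_Suc)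

lemma coeff_mult_3:
  "coeff (g * h) 3 =
    coeff g 0 * coeff h 3 + coeff g 1 * coeff h 2 + coeff g 2 * coeff h 1 + coeff g 3 * coeff h 0"
  for g h :: "'a :: comm_semiring_0 poly"
  by (simp add: coeff_mult numeral_eq_Suc)

text \<open>
  For a polynomial with constant coefficient \<open>\<plusminus>p^u\<close> the multiplicity here is \<open>u\<close>, so \<open>m dvd u\<close>
  contradicts \<open>u \<noteq> 0\<close> modulo \<open>m\<close> when \<open>m\<close> is \<open>2\<close> or \<open>3\<close>. Divisibility by \<open>m = 1\<close> carries no
  information, so there the factorisation itself is excluded: modulo \<open>p\<close> the product has order
  at least \<open>2\<close> at \<open>0\<close>.
\<close>

lemma low_coeffs_of_factorisation:
  fixes p :: int and g h :: "int poly"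
  assumes p: "prime_elem p"
    and const: "p dvd coeff g 0" "p dvd coeff h 0" "coeff g 0 \<noteq> 0" "coeff h 0 \<noteq> 0"
    and gap: "\<And>k. 0 < k \<Longrightarrow> k < m \<Longrightarrow> coeff (g * h) k = 0"
    and ndvd: "\<not> p dvd coeff (g * h) m"
    and m: "m \<in> {1, 2, 3}"
  shows "m \<noteq> 1 \<and> m dvd multiplicity p (coeff (g * h) 0)"
proof -
  have mult0: "multiplicity p (coeff (g * h) 0) =
      multiplicity p (coeff g 0) + multiplicity p (coeff h 0)"
    using p const by (simp add: mult_poly_0 coeff_mult_0 prime_elem_multiplicity_mult_distrib)
  consider "m = 1" | "m = 2" | "m = 3"
    using m by auto
  thus ?thesis
  proof cases
    case 1
    hence False
      using ndvd const by (simp add: coeff_mult_1 [unfolded One_nat_def])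
    thus ?thesis ..
  next
    case 2
    have "coeff (g * h) 1 = 0"
      using gap 2 by simp
    hence "coeff g 0 * coeff h 1 = - (coeff g 1 * coeff h 0)"
      unfolding coeff_mult_1 by linarith
    hence eq: "multiplicity p (coeff g 0 * coeff h 1) = multiplicity p (coeff g 1 * coeff h 0)"
      by simp
    have "\<not> p dvd coeff g 1 * coeff h 1"
      using ndvd const unfolding 2 coeff_mult_2 by (auto simp: dvd_add_left_iff dvd_add_right_iff)
    hence units: "\<not> p dvd coeff g 1" "\<not> p dvd coeff h 1"
      by auto
    hence "coeff g 1 \<noteq> 0" "coeff h 1 \<noteq> 0"
      by auto
    with eq units p const have "multiplicity p (coeff g 0) = multiplicity p (coeff h 0)"
      by (simp add: prime_elem_multiplicity_mult_distrib not_dvd_imp_multiplicity_0)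
    with mult0 2 show ?thesis
      by simp
  next
    case 3
    have x1: "coeff g 0 * coeff h 1 + coeff g 1 * coeff h 0 = 0"
      using gap [of 1] 3 unfolding coeff_mult_1 by simp
    have x2: "coeff g 0 * coeff h 2 + coeff g 1 * coeff h 1 + coeff g 2 * coeff h 0 = 0"
      using gap [of 2] 3 unfolding coeff_mult_2 by simp
    have "coeff g 1 * coeff h 1 = - (coeff g 0 * coeff h 2 + coeff g 2 * coeff h 0)"
      using x2 by linarith
    hence "p dvd coeff g 1 * coeff h 1"
      using const by simp
    hence d1: "p dvd coeff g 1 \<or> p dvd coeff h 1"
      using p by (simp add: prime_elem_dvd_mult_iff)
    have d3: "\<not> p dvd coeff g 1 * coeff h 2 + coeff g 2 * coeff h 1"
    proof
      assume "p dvd coeff g 1 * coeff h 2 + coeff g 2 * coeff h 1"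
      hence "p dvd coeff g 0 * coeff h 3 + (coeff g 1 * coeff h 2 + coeff g 2 * coeff h 1)
          + coeff g 3 * coeff h 0"
        by (rule dvd_add [OF dvd_add [OF dvd_mult2 [OF const(1)]] dvd_mult [OF const(2)]])
      with ndvd show False
        unfolding 3 coeff_mult_3 by (simp add: add.assoc)
    qed
    show ?thesis
    proof (cases "p dvd coeff g 1")
      case False
      hence "p dvd coeff h 1"
        using d1 by simp
      moreover have "\<not> p dvd coeff h 2"
        using d3 \<open>p dvd coeff h 1\<close> by auto
      ultimately have "multiplicity p (coeff h 0) = 2 * multiplicity p (coeff g 0)"
        using False by (intro multiplicity_double_if_low_coeffs_vanish [OF p const(3,4) x1 x2])
      with mult0 3 show ?thesis
        by simp
    next
      case True
      have "\<not> p dvd coeff h 1" "\<not> p dvd coeff g 2"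
        using d3 True by auto
      moreover have "coeff h 0 * coeff g 1 + coeff h 1 * coeff g 0 = 0"
        "coeff h 0 * coeff g 2 + coeff h 1 * coeff g 1 + coeff h 2 * coeff g 0 = 0"
        using x1 x2 by (simp_all add: algebra_simps)
      ultimately have "multiplicity p (coeff g 0) = 2 * multiplicity p (coeff h 0)"
        using True by (intro multiplicity_double_if_low_coeffs_vanish [OF p const(4,3)])
      with mult0 3 show ?thesis
        by simp
    qed
  qed
qed

section \<open>Irreducibility\<close>

theorem theorem3:
  fixes p r u :: nat and n :: "nat \<Rightarrow> nat" and a :: "nat \<Rightarrow> int"
    and \<epsilon> :: int and f :: "int poly"
  assumes "prime p"
    and "S_form p r n a u \<epsilon> f"
    and "f \<in> S p 1 \<union> S' p 2 \<union> S' p 3"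
    and "int p ^ u > (\<Sum>i=1..r. \<bar>a i\<bar>)"
  shows "irreducible f"
proof -
  have p: "prime_elem (int p)"
    using assms(1) by simp
  have \<epsilon>: "is_unit \<epsilon>" and "r \<ge> 1" and "\<not> int p dvd a r" "u \<ge> 2"
    using assms(2) by (auto simp: S_form_def)
  hence lead: "\<not> int p dvd coeff f (n r)"
    using coeff_S_form_exponent [OF assms(2), of r] by simp
  have const: "coeff f 0 = int p ^ u * \<epsilon>"
    by (rule coeff_S_form_0 [OF assms(2)])
  hence const_nz: "coeff f 0 \<noteq> 0"
    using assms(1) \<epsilon> by auto
  obtain m where m: "m \<in> {1, 2, 3}" and gap: "\<And>k. 0 < k \<Longrightarrow> k < m \<Longrightarrow> coeff f k = 0"
    and ndvd_m: "\<not> int p dvd coeff f m"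
    and mult: "m = 1 \<or> \<not> m dvd multiplicity (int p) (coeff f 0)"
  proof -
    \<comment> \<open>Membership provides a presentation of its own, whose exponent need not be \<open>u\<close> a priori;
      hence the conclusion is phrased with the valuation of the constant coefficient.\<close>
    obtain r' n' a' u' \<epsilon>' where form: "S_form p r' n' a' u' \<epsilon>' f"
      and n': "n' 1 \<in> {1, 2, 3}" "n' 1 = 1 \<or> \<not> n' 1 dvd u'"
      using assms(3) by (auto simp: S_def S'_def cong_0_iff)
    have "r' \<ge> 1" "\<not> int p dvd a' 1" and \<epsilon>': "is_unit \<epsilon>'"
      using form by (auto simp: S_form_def)
    hence "\<not> int p dvd coeff f (n' 1)"
      using coeff_S_form_exponent [OF form, of 1] by simp
    moreover have "multiplicity (int p) (coeff f 0) = u'"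
      using p \<epsilon>' unfolding coeff_S_form_0 [OF form] mult.commute [of _ \<epsilon>']
      by (subst multiplicity_times_unit_right) (auto simp: multiplicity_same_power)
    ultimately show thesis
      using n' coeff_S_form_gap [OF form] by (intro that [of "n' 1"]) auto
  qed
  have const_factor: "is_unit g" if "degree g = 0" "g dvd f" for g
  proof -
    obtain c where g: "g = [:c:]"
      using \<open>degree g = 0\<close> by (rule degree_eq_zeroE)
    have c: "c dvd coeff f k" for k
      using \<open>g dvd f\<close> unfolding g by (simp add: const_poly_dvd_iff)
    have "c dvd int p ^ u"
      using c [of 0] \<epsilon> by (simp add: const dvd_mult_unit_iff)
    moreover have "\<not> int p dvd c"
      using c [of "n r"] lead dvd_trans by blast
    ultimately have "is_unit c"
      by (rule unit_if_dvd_prime_power [OF p])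
    thus ?thesis
      unfolding g by (simp add: is_unit_const_poly_iff)
  qed
  have dvd_const: "int p dvd coeff g 0" if "degree g > 0" "g dvd f" for g
  proof (rule ccontr)
    obtain h where f: "f = g * h"
      using \<open>g dvd f\<close> by (elim dvdE)
    assume "\<not> int p dvd coeff g 0"
    moreover have "coeff g 0 dvd coeff f 0"
      by (simp add: f coeff_mult_0)
    hence "coeff g 0 dvd int p ^ u"
      using \<epsilon> by (simp add: const dvd_mult_unit_iff)
    ultimately have "is_unit (coeff g 0)"
      using unit_if_dvd_prime_power [OF p] by blast
    moreover have "\<bar>coeff g 0\<bar> > 1"
    proof (rule abs_constant_coeff_gt_1_if_roots_outside_disc [OF \<open>degree g > 0\<close>])
      fix z :: complex
      assume "poly (map_poly of_int g) z = 0"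
      hence "poly (map_poly of_int f) z = 0"
        by (simp add: f map_poly_of_int_mult)
      thus "norm z > 1"
        by (rule norm_root_S_form_gt_1 [OF assms(2,4)])
    qed
    ultimately show False
      by simp
  qed
  show ?thesis
  proof (rule irreducibleI)
    show "f \<noteq> 0"
      using const_nz by auto
    show "\<not> is_unit f"
    proof
      assume "is_unit f"
      hence "is_unit (coeff f 0)"
        by (auto simp: is_unit_poly_iff)
      hence "is_unit (int p ^ u)"
        using \<epsilon> by (simp add: const abs_mult)
      thus False
        using p \<open>u \<ge> 2\<close> by (simp add: is_unit_power_iff prime_elem_not_unit)
    qed
    show "is_unit g \<or> is_unit h" if f: "f = g * h" for g h
    proof (rule ccontr)
      assume "\<not> (is_unit g \<or> is_unit h)"
      hence "degree g > 0" "degree h > 0"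
        using const_factor f by (metis dvd_triv_left dvd_triv_right gr0I)+
      hence "int p dvd coeff g 0" "int p dvd coeff h 0"
        using dvd_const f by simp_all
      moreover have "coeff g 0 \<noteq> 0" "coeff h 0 \<noteq> 0"
        using const_nz by (auto simp: f coeff_mult_0)
      ultimately have "m \<noteq> 1 \<and> m dvd multiplicity (int p) (coeff f 0)"
        using low_coeffs_of_factorisation [OF p _ _ _ _ _ _ m, of g h] gap ndvd_m by (simp add: f)
      with mult show False
        by blast
    qed
  qed
qed

end
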